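(* Let $A\in\mathbb{R}^{N\times n}$ with $N\ge n\ge2$ have full column rank and columns of unit Euclidean norm, let $b\in\mathbb{R}^N$, and let $x^\star=\arg\min_x\|Ax-b\|_2$. Let $X=A^TA$, $\rho_2=\max_l\frac1n\sum_{r=1}^nX_{lr}^2$, $\sigma_{\max}$ the largest singular value of $A$, and $\kappa$ the ratio of the largest to the smallest singular value of $A$. Consider the iteration defined in the context with $0\le\beta<1$, deterministic $x_0$, nonnegative integer $\tau$, and deterministic sets $K(j)$ with $\{i:0\le i\le j-\tau-1\}\subseteq K(j)\subseteq\{0,\dots,j-1\}$. Let $\omega_\tau(\beta)=2\beta(1-\beta-\rho_2\tau^2\beta/2)$ and suppose $\omega_\tau(\beta)>0$. Then: (a) For every integer $m\ge\frac{\log(1/2)}{\log(1-\sigma_{\max}^2/n)}$, \[\mathbb{E}\big[\|x_m-x^\star\|_X^2\big]\le\Big(1-\frac{\omega_\tau(\beta)}{2\kappa^2}\Big)\|x_0-x^\star\|_X^2.\] (b) Let $T_0=\big\lceil\frac{\log(1/2)}{\log(1-\sigma_{\max}^2/n)}\big\rceil$, $T=T_0+\tau$, and \[\chi(\beta)=\frac{\rho_2\tau^3\beta^2\sigma_{\max}^2(1-\sigma_{\max}^2/n)^{-2\tau}}{n}.\] Then for every integer $r\ge1$ and every $m\ge rT$, \[\mathbb{E}\big[\|x_m-x^\star\|_X^2\big]\le\Big(1-\frac{\omega_\tau(\beta)}{2\kappa^2}\Big)\Big(1-\frac{\omega_\tau(\beta)(1-\sigma_{\max}^2/n)^{\ta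u}}{2\kappa^2}+\chi(\beta)\Big)^{r-1}\|x_0-x^\star\|_X^2.\]
   Context: $\|v\|_X^2:=v^TXv$ for $X=A^TA$. $e^{(1)},\dots,e^{(n)}$ are the standard basis vectors of $\mathbb{R}^n$. The iteration: let $d_0,d_1,\dots$ be i.i.d. random vectors, each uniformly distributed on $\{e^{(1)},\dots,e^{(n)}\}$; $K(0),K(1),\dots$ are deterministic sets (not depending on the $d_j$); given $x_0\in\mathbb{R}^n$ and step size $\beta$, define recursively for $j\ge0$ \[x_{K(j)}=x_0+\sum_{i\in K(j)}\beta\gamma_id_i,\qquad \gamma_j=d_j^TA^T(b-Ax_{K(j)}),\qquad x_{j+1}=x_j+\beta\gamma_jd_j.\] *)

theory Defs
  imports "HOL-Analysis.Analysis" "HOL-Probability.Probability"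
begin

definition normX_sq :: "real^'n^'n \<Rightarrow> real^'n \<Rightarrow> real" where
  "normX_sq X v = v \<bullet> (X *v v)"

definition ebasis :: "'n::finite \<Rightarrow> real^'n" where
  "ebasis i = axis i 1"

definition eigvals :: "real^'n^'n \<Rightarrow> real set" where
  "eigvals X = {\<mu>. \<exists>v. v \<noteq> 0 \<and> X *v v = \<mu> *\<^sub>R v}"

definition sigma_max :: "real^'n::finite^'m::finite \<Rightarrow> real" where
  "sigma_max A = sqrt (Max (eigvals (transpose A ** A)))"

definition sigma_min :: "real^'n::finite^'m::finite \<Rightarrow> real" where
  "sigma_min A = sqrt (Min (eigvals (transpose A ** A)))"

definition kappa :: "real^'n::finite^'m::finite \<Rightarrow> real" where
  "kappa A = sigma_max A / sigma_min A"

definition rho2 :: "real^'n::finite^'m::finite \<Rightarrow> real" where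
  "rho2 A = Max (range (\<lambda>l. (\<Sum>r\<in>UNIV. ((transpose A ** A) $ l $ r)^2) / real CARD('n)))"

text \<open>gamma_j for a realisation d of the random directions (d j is the index of
  the basis vector d_j):
  gamma_j = d_j^T A^T (b - A x_{K(j)}),  x_{K(j)} = x0 + sum_{i in K(j)} beta gamma_i d_i.
  (K(j) is assumed to be a subset of {0..j-1}; the intersection with {..<j} only
  makes the recursion well-founded.)\<close>
function gam :: "real^'n::finite^'m::finite \<Rightarrow> real^'m \<Rightarrow> real^'n \<Rightarrow> real
      \<Rightarrow> (nat \<Rightarrow> nat set) \<Rightarrow> (nat \<Rightarrow> 'n) \<Rightarrow> nat \<Rightarrow> real" where
  "gam A b x0 \<beta> K d j =
     (transpose A *v (b - A *v (x0 + (\<Sum>i\<in>K j \<inter> {..<j}. (\<beta> * gam A b x0 \<beta> K d i) *\<^sub>R ebasis (d i))))) $ d j"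
  by auto
termination
  by (relation "Wellfounded.measure (\<lambda>(A,b,x0,\<beta>,K,d,j). j)") auto

primrec xiter :: "real^'n::finite^'m::finite \<Rightarrow> real^'m \<Rightarrow> real^'n \<Rightarrow> real
      \<Rightarrow> (nat \<Rightarrow> nat set) \<Rightarrow> (nat \<Rightarrow> 'n) \<Rightarrow> nat \<Rightarrow> real^'n" where
  "xiter A b x0 \<beta> K d 0 = x0"
| "xiter A b x0 \<beta> K d (Suc j) = xiter A b x0 \<beta> K d j + (\<beta> * gam A b x0 \<beta> K d j) *\<^sub>R ebasis (d j)"

definition dirs :: "nat \<Rightarrow> (nat \<Rightarrow> 'n::finite) pmf" where
  "dirs m = Pi_pmf {..<m} undefined (\<lambda>_. pmf_of_set (UNIV :: 'n set))"

definition omega :: "real \<Rightarrow> nat \<Rightarrow> real \<Rightarrow> real" where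
  "omega rho \<tau> \<beta> = 2 * \<beta> * (1 - \<beta> - rho * real \<tau>^2 * \<beta> / 2)"

end

theory Submission
  imports Defs
begin

text \<open>
  Write X for the Gram matrix and measure errors in the X-norm. By the normal equations a step only
  sees the error of the iterate that was read, and replacing the current error by the one read costs
  a cross term in the at most \<open>\<tau>\<close> missing updates. Cauchy-Schwarz and averaging over the fresh
  direction (which produces \<open>\<rho>\<^sub>2\<close>) bound it by the preceding \<open>\<tau>\<close> values of \<open>E[\<gamma>\<^sub>i\<^sup>2]\<close>, so summing the
  steps yields a decrease of \<open>\<omega>\<close> times \<open>\<Sum>E[\<gamma>\<^sub>j\<^sup>2]\<close>. Conversely no step beats an exact line search,
  hence errors shrink by at most \<open>q = 1 - \<sigma>\<^sub>m\<^sub>a\<^sub>x\<^sup>2 / n\<close> per step, which bounds the \<open>E[\<gamma>\<^sub>j\<^sup>2]\<close> below; this is (a).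

  For an epoch starting at a later time s, the windows reaching back before s leave an extra term,
  which has to be bounded by \<open>\<chi>\<close> times the error at time s. If \<open>\<chi>\<close> is at least the claimed
  decrement, the factor is at least 1 and (a) suffices. Otherwise \<open>\<chi> \<le> 1/4\<close>, and then the descent
  estimate, applied along the (not necessarily contiguous) read sets, shows inductively that a read
  iterate has error at most \<open>4 / (3 q\<^sup>\<tau>)\<close> times that of the current one.
\<close>

section \<open>Spectral bounds for Gram matrices\<close>

lemma linear_coeff_zero_if_quadratic_nonneg:
  fixes p c :: real
  assumes "\<And>t. 0 \<le> 2 * t * p + t\<^sup>2 * c"
  shows "p = 0"
proof (rule ccontr)
  assume "p \<noteq> 0"
  \<comment> \<open>Replacing \<open>c\<close> by the positive upper bound \<open>e\<close> makes
    \<open>t = - p / e\<close> a legitimate test value whatever the sign of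
    \<open>c\<close>.\<close>
  define e where "e = \<bar>c\<bar> + 1"
  have e: "e > 0" "c \<le> e" by (auto simp: e_def)
  have "0 \<le> 2 * (- p / e) * p + (- p / e)\<^sup>2 * c" by (rule assms)
  also have "\<dots> \<le> 2 * (- p / e) * p + (- p / e)\<^sup>2 * e"
    using e by (intro add_left_mono mult_left_mono) auto
  also have "\<dots> = - (p\<^sup>2 / e)"
    using e by (simp add: field_simps power2_eq_square)
  also have "\<dots> < 0" using e \<open>p \<noteq> 0\<close> by simp
  finally show False by simp
qed

text \<open>The Rayleigh quotient attains its maximum on the compact unit sphere, and the
  first-order condition at a maximiser is the eigenvector equation.\<close>

lemma selfadjoint_max_eigenvector:
  fixes f :: "'a::euclidean_space \<Rightarrow> 'a"
  assumes "linear f" and sym: "\<And>x y. f x \<bullet> y = x \<bullet> f y"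
  obtains \<mu> v where "v \<noteq> 0" "f v = \<mu> *\<^sub>R v" "\<And>w. w \<bullet> f w \<le> \<mu> * (w \<bullet> w)"
proof -
  interpret linear f by fact
  have "continuous_on (sphere 0 1) f"
    by (rule linear_continuous_on) (simp add: assms(1) linear_conv_bounded_linear[symmetric])
  then have "continuous_on (sphere 0 1) (\<lambda>w. w \<bullet> f w)"
    by (intro continuous_intros)
  moreover have "sphere (0::'a) 1 \<noteq> {}" by simp
  ultimately obtain v where v: "v \<in> sphere 0 1" "\<And>w. w \<in> sphere 0 1 \<Longrightarrow> w \<bullet> f w \<le> v \<bullet> f v"
    using continuous_attains_sup[of "sphere 0 1" "\<lambda>w. w \<bullet> f w"] by auto
  define \<mu> where "\<mu> = v \<bullet> f v"
  have vv: "v \<bullet> v = 1" using v(1) by (simp add: dot_square_norm)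
  have max: "w \<bullet> f w \<le> \<mu> * (w \<bullet> w)" for w
  proof (cases "w = 0")
    case False
    have "(w /\<^sub>R norm w) \<bullet> f (w /\<^sub>R norm w) \<le> \<mu>"
      unfolding \<mu>_def using False by (intro v(2)) simp
    then have "w \<bullet> f w / (norm w * norm w) \<le> \<mu>"
      by (simp add: scale field_simps)
    then show ?thesis
      using False by (simp add: field_simps dot_square_norm power2_eq_square)
  qed simp
  \<comment> \<open>Perturbing the maximiser to \<open>v + t *\<^sub>R z\<close> gives a nonnegative
    quadratic in \<open>t\<close>, so its linear coefficient vanishes for every
    \<open>z\<close>.\<close>
  have "\<mu> * (v \<bullet> z) - z \<bullet> f v = 0" for z
  proof (rule linear_coeff_zero_if_quadratic_nonneg)
    fix t :: real
    have "(v + t *\<^sub>R z) \<bullet> f (v + t *\<^sub>R z) \<le> \<mu> * ((v + t *\<^sub>R z) \<bullet> (v + t *\<^sub>R z))"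
      by (rule max)
    moreover have "v \<bullet> f z = z \<bullet> f v" by (metis sym inner_commute)
    moreover have "v \<bullet> f v = \<mu> * (v \<bullet> v)" by (simp add: \<mu>_def vv)
    ultimately show "0 \<le> 2 * t * (\<mu> * (v \<bullet> z) - z \<bullet> f v) + t\<^sup>2 * (\<mu> * (z \<bullet> z) - z \<bullet> f z)"
      by (simp add: add scale inner_add_left inner_add_right inner_commute algebra_simps power2_eq_square)
  qed
  from this[of "f v - \<mu> *\<^sub>R v"] have "(f v - \<mu> *\<^sub>R v) \<bullet> (f v - \<mu> *\<^sub>R v) = 0"
    by (simp add: inner_diff_left inner_diff_right inner_commute algebra_simps)
  then have "f v = \<mu> *\<^sub>R v" by simp
  moreover have "v \<noteq> 0" using vv by auto
  ultimately show ?thesis using that max by blast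
qed

lemma inner_transpose_matrix_vector:
  fixes A :: "real^'n^'m"
  shows "v \<bullet> (transpose A *v u) = (A *v v) \<bullet> u"
  by (metis dot_lmul_matrix inner_commute transpose_matrix_vector)

lemma inner_gram:
  fixes A :: "real^'n^'m"
  shows "v \<bullet> ((transpose A ** A) *v w) = (A *v v) \<bullet> (A *v w)"
  by (metis inner_transpose_matrix_vector matrix_vector_mul_assoc)

text \<open>Eigenvectors for distinct eigenvalues are orthogonal, hence independent, so choosing one
  per eigenvalue injects the spectrum into a finite set. Only then do \<open>Max\<close> and
  \<open>Min\<close> of the spectrum have their usual meaning.\<close>

lemma finite_eigvals_gram:
  fixes A :: "real^'n^'m"
  shows "finite (eigvals (transpose A ** A))"
proof -
  let ?X = "transpose A ** A"
  define w where "w \<mu> = (SOME v. v \<noteq> 0 \<and> ?X *v v = \<mu> *\<^sub>R v)" for \<mu>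
  have w: "w \<mu> \<noteq> 0" "?X *v w \<mu> = \<mu> *\<^sub>R w \<mu>" if "\<mu> \<in> eigvals ?X" for \<mu>
    using that someI_ex[of "\<lambda>v. v \<noteq> 0 \<and> ?X *v v = \<mu> *\<^sub>R v"]
    unfolding w_def eigvals_def by auto
  have orth: "w \<mu> \<bullet> w \<nu> = 0" if "\<mu> \<in> eigvals ?X" "\<nu> \<in> eigvals ?X" "\<mu> \<noteq> \<nu>" for \<mu> \<nu>
  proof -
    have "w \<mu> \<bullet> (?X *v w \<nu>) = w \<nu> \<bullet> (?X *v w \<mu>)"
      by (simp add: inner_gram inner_commute)
    then have "\<nu> * (w \<mu> \<bullet> w \<nu>) = \<mu> * (w \<mu> \<bullet> w \<nu>)"
      using that by (simp add: w inner_commute)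
    then show ?thesis using that by simp
  qed
  have "inj_on w (eigvals ?X)"
    using orth w(1) by (intro inj_onI) (metis inner_eq_zero_iff)
  moreover have "pairwise orthogonal (w ` eigvals ?X)"
    unfolding pairwise_def orthogonal_def using orth by auto
  then have "independent (w ` eigvals ?X)"
    using w(1) by (intro pairwise_orthogonal_independent) auto
  then have "finite (w ` eigvals ?X)"
    by (rule independent_imp_finite)
  ultimately show ?thesis by (metis finite_imageD)
qed

lemma eigvals_gram_Max:
  fixes A :: "real^'n^'m"
  defines "\<mu> \<equiv> Max (eigvals (transpose A ** A))"
  shows "\<mu> \<in> eigvals (transpose A ** A)" "norm (A *v w) ^ 2 \<le> \<mu> * norm w ^ 2"
proof -
  let ?X = "transpose A ** A"
  obtain \<nu> v where v: "v \<noteq> 0" "?X *v v = \<nu> *\<^sub>R v" "\<And>w. w \<bullet> (?X *v w) \<le> \<nu> * (w \<bullet> w)"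
    by (rule selfadjoint_max_eigenvector[of "\<lambda>w. ?X *v w"])
      (auto simp: inner_gram inner_commute[of "?X *v _"] inner_commute)
  have "\<nu> \<in> eigvals ?X" using v by (auto simp: eigvals_def)
  with finite_eigvals_gram[of A] show "\<mu> \<in> eigvals ?X"
    unfolding \<mu>_def by (intro Max_in) auto
  have "\<nu> \<le> \<mu>"
    unfolding \<mu>_def using \<open>\<nu> \<in> eigvals ?X\<close> finite_eigvals_gram by (intro Max_ge)
  have "norm (A *v w) ^ 2 \<le> \<nu> * norm w ^ 2"
    using v(3)[of w] by (simp add: inner_gram dot_square_norm)
  also have "\<dots> \<le> \<mu> * norm w ^ 2"
    using \<open>\<nu> \<le> \<mu>\<close> by (intro mult_right_mono) auto
  finally show "norm (A *v w) ^ 2 \<le> \<mu> * norm w ^ 2" .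
qed

text \<open>The Rayleigh argument for the maximum, applied to the negated matrix.\<close>

lemma eigvals_gram_Min:
  fixes A :: "real^'n^'m"
  defines "\<mu> \<equiv> Min (eigvals (transpose A ** A))"
  shows "\<mu> \<in> eigvals (transpose A ** A)" "\<mu> * norm w ^ 2 \<le> norm (A *v w) ^ 2"
proof -
  let ?X = "transpose A ** A"
  have "linear (\<lambda>w. - (?X *v w))"
    by (intro linear_compose_neg matrix_vector_mul_linear)
  then obtain \<nu> v where v: "v \<noteq> 0" "- (?X *v v) = \<nu> *\<^sub>R v"
      "\<And>w. w \<bullet> - (?X *v w) \<le> \<nu> * (w \<bullet> w)"
    by (rule selfadjoint_max_eigenvector)
      (auto simp: inner_gram inner_commute[of "?X *v _"] inner_commute)
  have "?X *v v = (- \<nu>) *\<^sub>R v" using v(2) by (metis minus_minus scaleR_minus_left)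
  then have "- \<nu> \<in> eigvals ?X" using v(1) by (auto simp: eigvals_def)
  with finite_eigvals_gram[of A] show "\<mu> \<in> eigvals ?X"
    unfolding \<mu>_def by (intro Min_in) auto
  have "\<mu> \<le> - \<nu>"
    unfolding \<mu>_def using \<open>- \<nu> \<in> eigvals ?X\<close> finite_eigvals_gram by (intro Min_le)
  then have "\<mu> * norm w ^ 2 \<le> - \<nu> * norm w ^ 2"
    by (intro mult_right_mono) auto
  also have "\<dots> \<le> norm (A *v w) ^ 2"
    using v(3)[of w] by (simp add: inner_gram dot_square_norm)
  finally show "\<mu> * norm w ^ 2 \<le> norm (A *v w) ^ 2" .
qed

lemma eigval_gram_nonneg:
  assumes "\<mu> \<in> eigvals (transpose A ** A)"
  shows "\<mu> \<ge> 0"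
proof -
  obtain v where v: "v \<noteq> 0" "(transpose A ** A) *v v = \<mu> *\<^sub>R v"
    using assms by (auto simp: eigvals_def)
  have "\<mu> * (v \<bullet> v) = (A *v v) \<bullet> (A *v v)"
    using v inner_gram[of v A v] by simp
  then have "\<mu> * (v \<bullet> v) \<ge> 0" by simp
  then show ?thesis using v(1) by (metis inner_gt_zero_iff linorder_not_less mult_neg_pos)
qed

text \<open>For \<open>?z = X w\<close> one has \<open>norm ?z ^ 2\<close> equal to the inner
  product of \<open>A ?z\<close> and \<open>A w\<close>; Cauchy-Schwarz and the Rayleigh bound at
  \<open>?z\<close> leave a common factor \<open>norm ?z ^ 2\<close> to cancel.\<close>

lemma norm_gram_le:
  fixes A :: "real^'n^'m"
  shows "norm ((transpose A ** A) *v w) ^ 2 \<le> Max (eigvals (transpose A ** A)) * norm (A *v w) ^ 2"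
proof -
  let ?X = "transpose A ** A" and ?\<mu> = "Max (eigvals (transpose A ** A))"
  let ?z = "?X *v w"
  have "norm ?z ^ 2 = (A *v ?z) \<bullet> (A *v w)"
    by (simp add: inner_gram flip: dot_square_norm)
  also have "\<dots> \<le> norm (A *v ?z) * norm (A *v w)" by (rule norm_cauchy_schwarz)
  finally have "(norm ?z ^ 2)\<^sup>2 \<le> (norm (A *v ?z) * norm (A *v w))\<^sup>2"
    by (intro power_mono) auto
  also have "\<dots> \<le> (?\<mu> * norm ?z ^ 2) * norm (A *v w) ^ 2"
    unfolding power_mult_distrib by (intro mult_right_mono eigvals_gram_Max) auto
  finally have "norm ?z ^ 2 * norm ?z ^ 2 \<le> norm ?z ^ 2 * (?\<mu> * norm (A *v w) ^ 2)"
    by (simp add: power2_eq_square mult_ac)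
  moreover have "?\<mu> \<ge> 0" using eigval_gram_nonneg eigvals_gram_Max(1) by blast
  ultimately show ?thesis
    by (cases "?z = 0") (simp_all only: mult_le_cancel_left_pos zero_less_power zero_less_norm_iff
      norm_zero power_zero_numeral mult_nonneg_nonneg zero_le_power2 simp_thms)
qed

text \<open>Dual argument: Cauchy-Schwarz for the inner product of \<open>w\<close> and
  \<open>X w\<close>, the lower Rayleigh bound at \<open>w\<close>, and cancellation of
  \<open>norm (A *v w) ^ 2\<close>.\<close>

lemma norm_gram_ge:
  fixes A :: "real^'n^'m"
  shows "Min (eigvals (transpose A ** A)) * norm (A *v w) ^ 2 \<le> norm ((transpose A ** A) *v w) ^ 2"
proof -
  let ?X = "transpose A ** A" and ?\<mu> = "Min (eigvals (transpose A ** A))"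
  have nn: "?\<mu> \<ge> 0" using eigval_gram_nonneg eigvals_gram_Min(1) by blast
  have "norm (A *v w) ^ 2 = w \<bullet> (?X *v w)"
    by (simp add: inner_gram dot_square_norm)
  also have "\<dots> \<le> norm w * norm (?X *v w)" by (rule norm_cauchy_schwarz)
  finally have "(norm (A *v w) ^ 2)\<^sup>2 \<le> (norm w * norm (?X *v w))\<^sup>2"
    by (intro power_mono) auto
  then have "?\<mu> * (norm (A *v w) ^ 2)\<^sup>2 \<le> ?\<mu> * (norm w * norm (?X *v w))\<^sup>2"
    using nn by (rule mult_left_mono)
  also have "\<dots> = (?\<mu> * norm w ^ 2) * norm (?X *v w) ^ 2"
    by (simp add: power_mult_distrib)
  also have "\<dots> \<le> norm (A *v w) ^ 2 * norm (?X *v w) ^ 2"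
    by (intro mult_right_mono eigvals_gram_Min) auto
  finally have "norm (A *v w) ^ 2 * (?\<mu> * norm (A *v w) ^ 2) \<le> norm (A *v w) ^ 2 * norm (?X *v w) ^ 2"
    by (simp add: power2_eq_square mult_ac)
  then show ?thesis
    by (cases "A *v w = 0") (simp_all only: mult_le_cancel_left_pos zero_less_power zero_less_norm_iff
      norm_zero power_zero_numeral mult_zero_right zero_le_power2 simp_thms)
qed

lemma gram_nth:
  fixes A :: "real^'n^'m"
  shows "(transpose A ** A) $ i $ j = column i A \<bullet> column j A"
  by (simp add: matrix_matrix_mult_def transpose_def column_def inner_vec_def)

lemma gram_sym:
  fixes A :: "real^'n^'m"
  shows "(transpose A ** A) $ i $ j = (transpose A ** A) $ j $ i"
  by (simp add: gram_nth inner_commute)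

text \<open>By injectivity the sum and the difference of two distinct unit columns are nonzero, so
  both 2 + 2 \<open>X $ i $ j\<close> and 2 - 2 \<open>X $ i $ j\<close> are positive.\<close>

lemma abs_gram_less_1:
  fixes A :: "real^'n^'m"
  assumes inj: "inj ((*v) A)" and unit: "\<And>i. norm (column i A) = 1" and "i \<noteq> j"
  shows "\<bar>(transpose A ** A) $ i $ j\<bar> < 1"
proof -
  have col: "A *v axis k 1 = column k A" for k
    by (rule matrix_vector_mult_basis)
  have pos: "0 < (A *v v) \<bullet> (A *v v)" if "v \<noteq> 0" for v
    using injD[OF inj, of v 0] that by auto
  have one: "column k A \<bullet> column k A = 1" for k
    using unit[of k] by (simp add: dot_square_norm)
  have ne: "axis i 1 + axis j 1 \<noteq> (0 :: real^'n)" "axis i 1 - axis j 1 \<noteq> (0 :: real^'n)"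
    using \<open>i \<noteq> j\<close> by (auto simp: vec_eq_iff axis_def intro!: exI[of _ i])
  show ?thesis
    using pos[OF ne(1)] pos[OF ne(2)]
    by (simp add: gram_nth matrix_vector_right_distrib matrix_vector_mult_diff_distrib col
        inner_add_left inner_add_right inner_diff_left inner_diff_right one inner_commute)
qed

text \<open>Gershgorin-style: in the row where the eigenvector has its largest entry, all
  coefficients are at most 1 in modulus, and a second index makes the bound strict. This is what
  gives \<open>q > 0\<close>.\<close>

lemma Max_eigvals_gram_less_card:
  fixes A :: "real^'n^'m"
  assumes "inj ((*v) A)" "\<And>i. norm (column i A) = 1" "CARD('n) \<ge> 2"
  shows "Max (eigvals (transpose A ** A)) < real CARD('n)"
proof -
  let ?X = "transpose A ** A" and ?\<mu> = "Max (eigvals (transpose A ** A))"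
  obtain v where v: "v \<noteq> 0" "?X *v v = ?\<mu> *\<^sub>R v"
    using eigvals_gram_Max(1)[of A] by (auto simp: eigvals_def)
  obtain i where i: "\<And>j. \<bar>v $ j\<bar> \<le> \<bar>v $ i\<bar>"
  proof -
    have "Max (range (\<lambda>j. \<bar>v $ j\<bar>)) \<in> range (\<lambda>j. \<bar>v $ j\<bar>)"
      by (intro Max_in) auto
    then obtain i where "Max (range (\<lambda>j. \<bar>v $ j\<bar>)) = \<bar>v $ i\<bar>" by (rule rangeE)
    then have "\<bar>v $ j\<bar> \<le> \<bar>v $ i\<bar>" for j
      using Max_ge[of "range (\<lambda>j. \<bar>v $ j\<bar>)" "\<bar>v $ j\<bar>"] by auto
    then show ?thesis by (rule that)
  qed
  have vi: "\<bar>v $ i\<bar> > 0"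
    using v(1) i by (metis abs_ge_zero abs_le_zero_iff less_eq_real_def vec_eq_iff zero_index)
  have "\<exists>j::'n. j \<noteq> i"
  proof (rule ccontr)
    assume "\<not> ?thesis"
    then have "(UNIV :: 'n set) = {i}" by auto
    then have "CARD('n) = 1" by (metis is_singletonI is_singleton_altdef)
    with assms(3) show False by simp
  qed
  then obtain j where j: "j \<noteq> i" by blast
  have le1: "\<bar>?X $ i $ k\<bar> \<le> 1" for k
    using abs_gram_less_1[OF assms(1,2), of i k] assms(2)[of i]
    by (cases "i = k") (auto simp: gram_nth dot_square_norm)
  have "?\<mu> * \<bar>v $ i\<bar> = \<bar>(?X *v v) $ i\<bar>"
    using eigval_gram_nonneg[OF eigvals_gram_Max(1)[of A]] by (simp add: v(2) abs_mult)
  also have "\<dots> = \<bar>\<Sum>k\<in>UNIV. ?X $ i $ k * v $ k\<bar>"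
    by (simp only: matrix_vector_mult_def vec_lambda_beta)
  also have "\<dots> \<le> (\<Sum>k\<in>UNIV. \<bar>?X $ i $ k * v $ k\<bar>)" by (rule sum_abs)
  also have "\<dots> < (\<Sum>k\<in>(UNIV :: 'n set). \<bar>v $ i\<bar>)"
  proof (rule sum_strict_mono_ex1)
    show "\<forall>k\<in>UNIV. \<bar>?X $ i $ k * v $ k\<bar> \<le> \<bar>v $ i\<bar>"
      using mult_mono[OF le1 i] by (simp add: abs_mult)
    have "\<bar>?X $ i $ j\<bar> * \<bar>v $ j\<bar> \<le> \<bar>?X $ i $ j\<bar> * \<bar>v $ i\<bar>"
      using i by (intro mult_left_mono) auto
    also have "\<dots> < 1 * \<bar>v $ i\<bar>"
      using abs_gram_less_1[OF assms(1,2), of i j] j vi by (intro mult_strict_right_mono) auto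
    finally show "\<exists>k\<in>UNIV. \<bar>?X $ i $ k * v $ k\<bar> < \<bar>v $ i\<bar>"
      by (auto simp: abs_mult)
  qed simp
  finally show ?thesis using vi by simp
qed

section \<open>Normal equations and averaging over one direction\<close>

lemma least_squares_normal_equation:
  fixes A :: "real^'n^'m"
  assumes "\<And>x. norm (A *v xs - b) \<le> norm (A *v x - b)"
  shows "transpose A *v (b - A *v xs) = 0"
proof -
  define r where "r = A *v xs - b"
  define g where "g = transpose A *v r"
  have "g \<bullet> g = 0"
  proof (rule linear_coeff_zero_if_quadratic_nonneg)
    fix t :: real
    \<comment> \<open>Moving along the gradient \<open>g\<close> itself makes the linear coefficient
      equal to \<open>g \<bullet> g\<close>.\<close>
    have "A *v (xs + t *\<^sub>R g) - b = r + t *\<^sub>R (A *v g)"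
      by (simp add: r_def matrix_vector_right_distrib matrix_vector_mult_scaleR algebra_simps)
    then have "(norm r)\<^sup>2 \<le> (norm (r + t *\<^sub>R (A *v g)))\<^sup>2"
      using assms[of "xs + t *\<^sub>R g"] by (intro power_mono) (simp_all only: r_def norm_ge_zero)
    moreover have "r \<bullet> (A *v g) = g \<bullet> g"
      by (metis g_def inner_commute inner_transpose_matrix_vector)
    ultimately show "0 \<le> 2 * t * (g \<bullet> g) + t\<^sup>2 * ((A *v g) \<bullet> (A *v g))"
      unfolding power2_norm_eq_inner
      by (simp add: inner_add_left inner_add_right inner_commute power2_eq_square)
  qed
  then have "transpose A *v r = 0" by (simp add: g_def)
  moreover have "b - A *v xs = - r" by (simp add: r_def)
  ultimately show ?thesis
    by (metis minus_zero matrix_vector_mult_diff_distrib matrix_vector_mult_0_right diff_0)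
qed

text \<open>The coordinates are independent, so coordinate \<open>j\<close> can be averaged out
  first. This plays the role of conditional expectation given all other directions.\<close>

lemma expectation_dirs_resample:
  fixes h :: "(nat \<Rightarrow> 'n::finite) \<Rightarrow> real"
  assumes "j < M"
  shows "measure_pmf.expectation (dirs M) h =
    measure_pmf.expectation (dirs M) (\<lambda>d. (\<Sum>k\<in>UNIV. h (d(j := k))) / real CARD('n))"
proof -
  define P :: "(nat \<Rightarrow> 'n) pmf" where
    "P = Pi_pmf ({..<M} - {j}) undefined (\<lambda>_. pmf_of_set UNIV)"
  have fin: "finite (set_pmf P)"
    unfolding P_def by (subst set_Pi_pmf) (auto intro!: finite_PiE_dflt)
  have dirs: "dirs M = map_pmf (\<lambda>(y, f). f(j := y)) (pair_pmf (pmf_of_set UNIV) P)"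
    unfolding dirs_def P_def using assms
    by (subst Pi_pmf_insert[symmetric]) (auto simp: insert_absorb insert_Diff)
  have avg: "measure_pmf.expectation (dirs M) h' =
    measure_pmf.expectation P (\<lambda>f. (\<Sum>k\<in>UNIV. h' (f(j := k))) / real CARD('n))"
    for h' :: "(nat \<Rightarrow> 'n) \<Rightarrow> real"
  proof -
    have "dirs M = bind_pmf P (\<lambda>f. map_pmf (\<lambda>k. f(j := k)) (pmf_of_set UNIV))"
      unfolding dirs pair_pmf_def map_bind_pmf map_pmf_def
      by (subst bind_commute_pmf) (simp add: bind_assoc_pmf bind_return_pmf)
    then show ?thesis
      by (simp add: pmf_expectation_bind[OF fin] integral_pmf_of_set
          integral_measure_pmf[OF fin] sum_divide_distrib)
  qed
  show ?thesis
    \<comment> \<open>On the right the average is taken twice; the second update at \<open>j\<close>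
      overwrites the first, so averaging is idempotent.\<close>
    by (subst (1 2) avg) (simp add: sum_divide_distrib flip: sum_distrib_left)
qed

lemma normX_sq_gram: "normX_sq (transpose A ** A) v = (norm (A *v v))\<^sup>2"
  by (simp add: normX_sq_def inner_gram dot_square_norm)

lemma normX_sq_gram_nonneg: "0 \<le> normX_sq (transpose A ** A) v"
  by (simp add: normX_sq_gram)

section \<open>The asynchronous iteration and its errors\<close>

declare gam.simps [simp del]

text \<open>\<open>M\<close> is a horizon: all expectations live on the single finite space
  \<open>dirs M\<close>, and step indices stay below \<open>M\<close>.\<close>

locale async_least_squares =
  fixes A :: "real^'n::finite^'N::finite" and b :: "real^'N"
    and xstar x0 :: "real^'n" and \<beta> :: real and \<tau> :: nat
    and K :: "nat \<Rightarrow> nat set" and M :: nat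
  assumes card_ge_2: "CARD('n) \<ge> 2"
    and inj_A: "inj ((*v) A)"
    and unit_columns: "\<And>i. norm (column i A) = 1"
    and minimizer: "\<And>x. norm (A *v xstar - b) \<le> norm (A *v x - b)"
    and \<beta>_nonneg: "0 \<le> \<beta>" and \<beta>_less_1: "\<beta> < 1"
    and old_in_K: "\<And>i j. i + \<tau> < j \<Longrightarrow> i \<in> K j"
    and K_subset: "\<And>j. K j \<subseteq> {..<j}"
    and omega_positive: "0 < omega (rho2 A) \<tau> \<beta>"
begin

abbreviation X :: "real^'n^'n" where "X \<equiv> transpose A ** A"
abbreviation lmax :: real where "lmax \<equiv> Max (eigvals X)"
abbreviation lmin :: real where "lmin \<equiv> Min (eigvals X)"
abbreviation \<rho> :: real where "\<rho> \<equiv> rho2 A"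
abbreviation \<gamma> :: "(nat \<Rightarrow> 'n) \<Rightarrow> nat \<Rightarrow> real" where "\<gamma> \<equiv> gam A b x0 \<beta> K"
abbreviation E :: "((nat \<Rightarrow> 'n) \<Rightarrow> real) \<Rightarrow> real" where
  "E \<equiv> measure_pmf.expectation (dirs M)"

definition q :: real where "q = 1 - lmax / real CARD('n)"

text \<open>\<open>L\<close> is the set of updates already applied: \<open>{..<j}\<close> gives the
  error of the current iterate, \<open>K j\<close> that of the iterate read in step
  \<open>j\<close>, and other sets interpolate between them.\<close>

definition err :: "nat set \<Rightarrow> (nat \<Rightarrow> 'n) \<Rightarrow> real^'n" where
  "err L d = x0 - xstar + (\<Sum>i\<in>L. (\<beta> * \<gamma> d i) *\<^sub>R ebasis (d i))"

definition mse :: "nat set \<Rightarrow> real" where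
  "mse L = E (\<lambda>d. normX_sq X (err L d))"

definition msg :: "nat \<Rightarrow> real" where
  "msg j = E (\<lambda>d. (\<gamma> d j)\<^sup>2)"

lemma integrable_dirs [simp]: "integrable (measure_pmf (dirs m)) (h :: (nat \<Rightarrow> 'n) \<Rightarrow> real)"
proof (rule integrable_measure_pmf_finite)
  show "finite (set_pmf (dirs m :: (nat \<Rightarrow> 'n) pmf))"
    unfolding dirs_def by (subst set_Pi_pmf) (auto intro!: finite_PiE_dflt)
qed

lemma E_mono: "(\<And>d. f d \<le> h d) \<Longrightarrow> E f \<le> E h"
  by (rule integral_mono) auto

lemma mse_nonneg: "0 \<le> mse L"
  unfolding mse_def by (rule integral_nonneg_AE) (simp add: normX_sq_gram_nonneg)

lemma msg_nonneg: "0 \<le> msg j"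
  unfolding msg_def by (rule integral_nonneg_AE) simp

lemma card_pos: "real CARD('n) > 0"
  using card_ge_2 by linarith

lemma lmin_pos: "lmin > 0"
proof -
  obtain v where v: "v \<noteq> 0" "X *v v = lmin *\<^sub>R v"
    using eigvals_gram_Min(1)[of A] by (auto simp: eigvals_def)
  have "A *v v \<noteq> 0" using injD[OF inj_A, of v 0] v(1) by auto
  moreover have "lmin * (v \<bullet> v) = (A *v v) \<bullet> (A *v v)"
    using inner_gram[of v A v] v(2) by simp
  ultimately have "lmin \<noteq> 0" by auto
  with eigval_gram_nonneg[OF eigvals_gram_Min(1)] show ?thesis by (simp add: order_less_le)
qed

lemma lmin_le_lmax: "lmin \<le> lmax"
  by (rule Min_le[OF finite_eigvals_gram eigvals_gram_Max(1)])

lemma lmax_pos: "lmax > 0"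
  using lmin_pos lmin_le_lmax by linarith

lemma q_pos: "0 < q" and q_less_1: "q < 1"
  using Max_eigvals_gram_less_card[OF inj_A unit_columns card_ge_2] lmax_pos card_pos
  by (auto simp: q_def field_simps)

lemma sigma_max_sq: "(sigma_max A)\<^sup>2 = lmax"
  using lmax_pos by (simp add: sigma_max_def)

lemma kappa_sq: "(kappa A)\<^sup>2 = lmax / lmin"
  using lmax_pos lmin_pos by (simp add: kappa_def sigma_max_def sigma_min_def power_divide)

lemma rho2_ge: "(\<Sum>r\<in>UNIV. (X $ l $ r)\<^sup>2) / real CARD('n) \<le> \<rho>"
  unfolding rho2_def by (rule Max_ge) auto

lemma rho2_nonneg: "0 \<le> \<rho>"
proof -
  have "0 \<le> (\<Sum>r\<in>UNIV. (X $ undefined $ r)\<^sup>2) / real CARD('n)" by (simp add: sum_nonneg)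
  also have "\<dots> \<le> \<rho>" by (rule rho2_ge)
  finally show ?thesis .
qed

text \<open>Causality: the recursion for index \<open>i\<close> consults no direction after
  \<open>d i\<close>. Hence \<open>d j\<close> is fresh for everything computed before step
  \<open>j\<close>.\<close>

lemma gamma_upd: "i < j \<Longrightarrow> \<gamma> (d(j := k)) i = \<gamma> d i"
proof (induction i rule: less_induct)
  case (less i)
  have "(\<Sum>l\<in>K i \<inter> {..<i}. (\<beta> * \<gamma> (d(j := k)) l) *\<^sub>R ebasis ((d(j := k)) l)) =
        (\<Sum>l\<in>K i \<inter> {..<i}. (\<beta> * \<gamma> d l) *\<^sub>R ebasis (d l))"
    using less.IH less.prems by (intro sum.cong) (auto simp del: fun_upd_apply simp: fun_upd_other)
  then show ?case
    using less.prems by (subst (1 2) gam.simps) simp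
qed

lemma err_upd: "L \<subseteq> {..<j} \<Longrightarrow> err L (d(j := k)) = err L d"
  unfolding err_def by (intro arg_cong2[where f = "(+)"] refl sum.cong) (auto simp: gamma_upd)

lemma err_insert:
  "finite L \<Longrightarrow> j \<notin> L \<Longrightarrow> err (insert j L) d = err L d + (\<beta> * \<gamma> d j) *\<^sub>R ebasis (d j)"
  by (simp add: err_def)

lemma xiter_minus_xstar: "xiter A b x0 \<beta> K d j - xstar = err {..<j} d"
  by (induction j) (auto simp: err_def lessThan_Suc algebra_simps)

lemma gamma_eq: "\<gamma> d j = - (X *v err (K j) d) $ d j"
proof -
  define y where "y = x0 + (\<Sum>i\<in>K j \<inter> {..<j}. (\<beta> * \<gamma> d i) *\<^sub>R ebasis (d i))"
  have "K j \<inter> {..<j} = K j" using K_subset by auto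
  then have y: "y - xstar = err (K j) d" by (simp add: y_def err_def)
  have "b - A *v y = (b - A *v xstar) - A *v (y - xstar)"
    by (simp add: matrix_vector_mult_diff_distrib)
  then have "transpose A *v (b - A *v y) =
      transpose A *v (b - A *v xstar) - transpose A *v (A *v (y - xstar))"
    by (simp only: matrix_vector_mult_diff_distrib)
  also have "\<dots> = - (X *v (y - xstar))"
    by (simp only: least_squares_normal_equation[OF minimizer] matrix_vector_mul_assoc diff_0)
  finally show ?thesis
    by (subst gam.simps) (simp only: y_def[symmetric] y vector_uminus_component)
qed

section \<open>Effect of a single step\<close>

text \<open>The unit columns make the coefficient of \<open>t\<^sup>2\<close> equal to 1, so an
  exact line search gains exactly the square of component \<open>k\<close> of
  \<open>X *v v\<close>.\<close>

lemma normX_sq_step: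
  "normX_sq X (v + t *\<^sub>R ebasis k) = normX_sq X v + 2 * t * (X *v v) $ k + t\<^sup>2"
proof -
  have col: "A *v ebasis k = column k A"
    unfolding ebasis_def by (rule matrix_vector_mult_basis)
  have one: "column k A \<bullet> column k A = 1"
    using unit_columns[of k] by (simp add: dot_square_norm)
  have "(X *v v) $ k = ebasis k \<bullet> (X *v v)"
    by (simp add: ebasis_def inner_axis')
  also have "\<dots> = column k A \<bullet> (A *v v)" by (simp only: inner_gram col)
  finally show ?thesis
    by (simp add: normX_sq_def inner_gram matrix_vector_right_distrib matrix_vector_mult_scaleR
        col inner_add_left inner_add_right one inner_commute power2_eq_square algebra_simps
        del: transpose_matrix_vector)
qed

text \<open>The error over \<open>L\<close> does not involve \<open>d j\<close>, so averaging over
  \<open>d j\<close> turns one squared component into the mean of all of them.\<close>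

lemma E_resample_component:
  assumes "j < M" "L \<subseteq> {..<j}"
  shows "E (\<lambda>d. ((X *v err L d) $ d j)\<^sup>2) = E (\<lambda>d. (norm (X *v err L d))\<^sup>2) / real CARD('n)"
proof -
  have "(\<Sum>k\<in>UNIV. ((X *v v) $ k)\<^sup>2) = (norm (X *v v))\<^sup>2" for v
    by (simp only: norm_vec_def L2_set_def real_norm_def power2_abs)
      (simp add: sum_nonneg)
  then show ?thesis
    by (subst expectation_dirs_resample[OF assms(1)]) (simp only: err_upd[OF assms(2)] fun_upd_same, simp)
qed

lemma msg_bounds:
  assumes "j < M"
  shows "lmin / real CARD('n) * mse (K j) \<le> msg j" "msg j \<le> (1 - q) * mse (K j)"
proof -
  have eq: "msg j = E (\<lambda>d. (norm (X *v err (K j) d))\<^sup>2) / real CARD('n)"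
    unfolding msg_def gamma_eq using E_resample_component[OF assms K_subset] by simp
  have "lmin * mse (K j) \<le> E (\<lambda>d. (norm (X *v err (K j) d))\<^sup>2)"
    unfolding mse_def integral_mult_right_zero[symmetric] normX_sq_gram
    by (intro E_mono norm_gram_ge)
  then show "lmin / real CARD('n) * mse (K j) \<le> msg j"
    using card_pos by (simp add: eq field_simps)
  have "E (\<lambda>d. (norm (X *v err (K j) d))\<^sup>2) \<le> lmax * mse (K j)"
    unfolding mse_def integral_mult_right_zero[symmetric] normX_sq_gram
    by (intro E_mono norm_gram_le)
  then show "msg j \<le> (1 - q) * mse (K j)"
    using card_pos by (simp add: eq q_def field_simps)
qed

text \<open>No step along a coordinate direction beats the exact line search, whatever its length.\<close>
lemma mse_insert_ge:
  assumes "j < M" "L \<subseteq> {..<j}"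
  shows "q * mse L \<le> mse (insert j L)"
proof -
  have L: "finite L" "j \<notin> L" using assms finite_subset by auto
  have "mse L - E (\<lambda>d. ((X *v err L d) $ d j)\<^sup>2) =
      E (\<lambda>d. normX_sq X (err L d) - ((X *v err L d) $ d j)\<^sup>2)"
    unfolding mse_def by (intro Bochner_Integration.integral_diff[symmetric] integrable_dirs)
  also have "\<dots> \<le> mse (insert j L)"
    unfolding mse_def
  proof (rule E_mono)
    fix d
    define t c where "t = \<beta> * \<gamma> d j" and "c = (X *v err L d) $ d j"
    have "0 \<le> (t + c)\<^sup>2" by simp
    then have "- c\<^sup>2 \<le> 2 * t * c + t\<^sup>2" by (simp add: power2_eq_square algebra_simps)
    then show "normX_sq X (err L d) - ((X *v err L d) $ d j)\<^sup>2 \<le> normX_sq X (err (insert j L) d)"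
      unfolding err_insert[OF L] normX_sq_step by (simp only: t_def c_def)
  qed
  finally have "mse L - E (\<lambda>d. (norm (X *v err L d))\<^sup>2) / real CARD('n) \<le> mse (insert j L)"
    unfolding E_resample_component[OF assms] .
  moreover have "E (\<lambda>d. (norm (X *v err L d))\<^sup>2) \<le> lmax * mse L"
    unfolding mse_def integral_mult_right_zero[symmetric] normX_sq_gram
    by (intro E_mono norm_gram_le)
  ultimately show ?thesis
    using card_pos by (simp add: q_def field_simps)
qed

text \<open>Going up from \<open>s\<close>, an index in \<open>L\<close> costs one factor
  \<open>q\<close> by \<open>mse_insert_ge\<close>; for an index missing from \<open>L\<close> the
  factor is free because \<open>q < 1\<close>. Gaps in \<open>L\<close> are therefore
  harmless.\<close>

lemma mse_ge_power:
  assumes "{..<s} \<subseteq> L" "L \<subseteq> {..<s + k}" "s + k \<le> M"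
  shows "q ^ k * mse {..<s} \<le> mse L"
  using assms
proof (induction k arbitrary: L)
  case 0
  then have "L = {..<s}" by auto
  then show ?case by simp
next
  case (Suc k)
  define L' where "L' = L \<inter> {..<s + k}"
  have IH: "q ^ k * mse {..<s} \<le> mse L'"
    using Suc.prems by (intro Suc.IH) (auto simp: L'_def)
  have "q ^ Suc k * mse {..<s} \<le> q * mse L'"
    using mult_left_mono[OF IH, of q] q_pos by (simp add: mult_ac)
  also have "q * mse L' \<le> mse L"
  proof (cases "s + k \<in> L")
    case True
    then have "L = insert (s + k) L'" using Suc.prems(2) by (auto simp: L'_def less_Suc_eq)
    then show ?thesis
      using mse_insert_ge[of "s + k" L'] Suc.prems(3) by (simp add: L'_def)
  next
    case False
    then have "L = L'" using Suc.prems(2) by (auto simp: L'_def less_Suc_eq)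
    then show ?thesis
      using q_less_1 q_pos mse_nonneg[of L] mult_right_mono[of q 1 "mse L"] by simp
  qed
  finally show ?case .
qed

text \<open>\<open>L\<close> and \<open>K j\<close> agree below \<open>j - \<tau>\<close>, so their
  errors differ only by updates in the window \<open>?W\<close>. General \<open>L\<close>, rather
  than \<open>{..<j}\<close>, is what later allows the estimate to run along read sets.\<close>

lemma mse_insert_le:
  assumes "j < M" "L \<subseteq> {..<j}" "{..<j - \<tau>} \<subseteq> L"
  shows "mse (insert j L) \<le>
    mse L - 2 * \<beta> * (1 - \<beta>) * msg j + \<beta>\<^sup>2 * \<tau> * \<rho> * (\<Sum>i\<in>{j - \<tau>..<j}. msg i)"
proof -
  let ?W = "{j - \<tau>..<j}"
  have L: "finite L" "j \<notin> L" using assms finite_subset by auto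
  \<comment> \<open>\<open>s i\<close> is 1, -1 or 0: the update is in \<open>L\<close> only, in
    \<open>K j\<close> only, or in both or neither.\<close>
  define s :: "nat \<Rightarrow> real" where "s i = of_bool (i \<in> L) - of_bool (i \<in> K j)" for i
  have s: "(s i)\<^sup>2 \<le> 1" for i by (simp add: s_def)
  have s0: "s i = 0" if "i < j - \<tau>" for i
    using that assms(3) old_in_K[of i j] by (auto simp: s_def)
  define Z where "Z d = (\<Sum>i\<in>?W. s i * \<gamma> d i * X $ d j $ d i)" for d
  have diff: "err L d = err (K j) d + (\<Sum>i\<in>?W. (s i * (\<beta> * \<gamma> d i)) *\<^sub>R ebasis (d i))" for d
  proof -
    \<comment> \<open>Indicator coefficients put both errors on the common index set
      \<open>{..<j}\<close>, so that they can be subtracted termwise.\<close>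
    have ext: "err S d = x0 - xstar + (\<Sum>i<j. (of_bool (i \<in> S) * (\<beta> * \<gamma> d i)) *\<^sub>R ebasis (d i))"
      if "S \<subseteq> {..<j}" for S
      unfolding err_def using that
      by (intro arg_cong2[where f = "(+)"] refl sum.mono_neutral_cong_left) auto
    have "(\<Sum>i<j. (s i * (\<beta> * \<gamma> d i)) *\<^sub>R ebasis (d i)) =
        (\<Sum>i\<in>?W. (s i * (\<beta> * \<gamma> d i)) *\<^sub>R ebasis (d i))"
      by (intro sum.mono_neutral_right) (auto simp: s0)
    then show ?thesis
      unfolding ext[OF assms(2)] ext[OF K_subset]
      by (simp add: s_def algebra_simps sum_subtractf sum.distrib)
  qed
  have comp: "(X *v err L d) $ d j = - \<gamma> d j + \<beta> * Z d" for d
  proof -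
    have "(X *v (\<Sum>i\<in>?W. (s i * (\<beta> * \<gamma> d i)) *\<^sub>R ebasis (d i))) $ d j =
        (\<Sum>i\<in>?W. (s i * (\<beta> * \<gamma> d i)) * (X *v ebasis (d i)) $ d j)"
      by (simp only: linear_sum[OF matrix_vector_mul_linear] matrix_vector_mult_scaleR
          sum_component vector_scaleR_component real_scaleR_def)
    also have "\<dots> = \<beta> * Z d"
      unfolding Z_def sum_distrib_left ebasis_def matrix_vector_mult_basis
      by (intro sum.cong) (auto simp: column_def)
    finally show ?thesis
      by (simp only: diff matrix_vector_right_distrib vector_add_component gamma_eq minus_minus)
  qed
  have Z_le: "(Z d)\<^sup>2 \<le> \<tau> * (\<Sum>i\<in>?W. (\<gamma> d i)\<^sup>2 * (X $ d j $ d i)\<^sup>2)" for d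
  proof -
    have "(Z d)\<^sup>2 \<le> (\<Sum>i\<in>?W. (s i * \<gamma> d i * X $ d j $ d i)\<^sup>2) * card ?W"
      unfolding Z_def by (rule sum_squared_le_sum_of_squares)
    also have "\<dots> \<le> (\<Sum>i\<in>?W. (\<gamma> d i)\<^sup>2 * (X $ d j $ d i)\<^sup>2) * \<tau>"
    proof (intro mult_mono sum_mono)
      fix i
      show "(s i * \<gamma> d i * X $ d j $ d i)\<^sup>2 \<le> (\<gamma> d i)\<^sup>2 * (X $ d j $ d i)\<^sup>2"
        unfolding power_mult_distrib mult.assoc using s[of i]
        by (intro mult_left_le_one_le) auto
    qed (auto intro!: sum_nonneg)
    finally show ?thesis by (simp add: mult.commute)
  qed
  have pointwise: "normX_sq X (err (insert j L) d) \<le> normX_sq X (err L d)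
      - 2 * \<beta> * (1 - \<beta>) * (\<gamma> d j)\<^sup>2 + \<beta>\<^sup>2 * \<tau> * (\<Sum>i\<in>?W. (\<gamma> d i)\<^sup>2 * (X $ d j $ d i)\<^sup>2)" for d
  proof -
    \<comment> \<open>The cross term is split by 2 \<open>\<gamma>\<close> \<open>Z\<close> =
      \<open>\<gamma>\<close>^2 + \<open>Z\<close>^2 - (\<open>\<gamma>\<close> -
      \<open>Z\<close>)^2; the \<open>\<gamma>\<close>^2 part turns the coefficient into
      \<open>2 * \<beta> * (1 - \<beta>)\<close>.\<close>
    have "normX_sq X (err (insert j L) d) =
        normX_sq X (err L d) - 2 * \<beta> * (1 - \<beta>) * (\<gamma> d j)\<^sup>2 + \<beta>\<^sup>2 * (Z d)\<^sup>2
        - \<beta>\<^sup>2 * (\<gamma> d j - Z d)\<^sup>2"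
      unfolding err_insert[OF L] normX_sq_step comp
      by (simp add: power2_eq_square algebra_simps)
    also have "\<dots> \<le> normX_sq X (err L d) - 2 * \<beta> * (1 - \<beta>) * (\<gamma> d j)\<^sup>2 + \<beta>\<^sup>2 * (Z d)\<^sup>2"
      by simp
    finally show ?thesis
      using mult_left_mono[OF Z_le[of d], of "\<beta>\<^sup>2"] by (simp add: mult.assoc)
  qed
  \<comment> \<open>As \<open>i < j\<close>, neither \<open>\<gamma> d i\<close> nor
    \<open>d i\<close> depends on \<open>d j\<close>; averaging over \<open>d j\<close> leaves the
    mean square of a row of the symmetric matrix \<open>X\<close>.\<close>
  have cross: "E (\<lambda>d. (\<gamma> d i)\<^sup>2 * (X $ d j $ d i)\<^sup>2) \<le> \<rho> * msg i" if "i \<in> ?W" for i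
  proof -
    have i: "i < j" using that by simp
    have "E (\<lambda>d. (\<gamma> d i)\<^sup>2 * (X $ d j $ d i)\<^sup>2) =
        E (\<lambda>d. (\<gamma> d i)\<^sup>2 * ((\<Sum>k\<in>UNIV. (X $ d i $ k)\<^sup>2) / real CARD('n)))"
      using i by (subst expectation_dirs_resample[OF assms(1)])
        (simp add: gamma_upd gram_sym[of A _ "_ i"] flip: sum_distrib_left)
    also have "\<dots> \<le> E (\<lambda>d. (\<gamma> d i)\<^sup>2 * \<rho>)"
      by (intro E_mono mult_left_mono rho2_ge) auto
    finally show ?thesis by (simp add: msg_def mult.commute)
  qed
  have "mse (insert j L) \<le> E (\<lambda>d. normX_sq X (err L d)
      - 2 * \<beta> * (1 - \<beta>) * (\<gamma> d j)\<^sup>2 + \<beta>\<^sup>2 * \<tau> * (\<Sum>i\<in>?W. (\<gamma> d i)\<^sup>2 * (X $ d j $ d i)\<^sup>2))"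
    unfolding mse_def by (intro E_mono pointwise)
  also have "\<dots> = mse L - 2 * \<beta> * (1 - \<beta>) * msg j
      + \<beta>\<^sup>2 * \<tau> * (\<Sum>i\<in>?W. E (\<lambda>d. (\<gamma> d i)\<^sup>2 * (X $ d j $ d i)\<^sup>2))"
    by (simp add: mse_def msg_def)
  also have "\<dots> \<le> mse L - 2 * \<beta> * (1 - \<beta>) * msg j + \<beta>\<^sup>2 * \<tau> * (\<Sum>i\<in>?W. \<rho> * msg i)"
    by (intro add_left_mono mult_left_mono sum_mono cross) auto
  finally show ?thesis by (simp add: mult.assoc flip: sum_distrib_left)
qed

section \<open>Descent over an epoch\<close>

abbreviation \<omega> :: real where "\<omega> \<equiv> omega \<rho> \<tau> \<beta>"

definition chi :: real where
  "chi = \<rho> * real \<tau> ^ 3 * \<beta>\<^sup>2 * (1 - q) / q ^ (2 * \<tau>)"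

lemma chi_nonneg: "chi \<ge> 0"
  using rho2_nonneg q_pos q_less_1 by (simp add: chi_def)

text \<open>Double counting: any \<open>i\<close> lies in at most \<open>\<tau>\<close> windows, and
  an \<open>i\<close> before \<open>s\<close> only in those of \<open>j\<close> from
  \<open>s\<close> to \<open>i + \<tau>\<close>.\<close>

lemma sum_windows_le:
  assumes "s \<le> m"
  shows "(\<Sum>j\<in>{s..<m}. \<Sum>i\<in>{j - \<tau>..<j}. msg i) \<le>
    real \<tau> * (\<Sum>i\<in>{s..<m}. msg i) + (\<Sum>i\<in>{s - \<tau>..<s}. real (i + \<tau> + 1 - s) * msg i)"
proof -
  have "(\<Sum>j\<in>{s..<m}. \<Sum>i\<in>{j - \<tau>..<j}. msg i) =
      (\<Sum>j\<in>{s..<m}. \<Sum>i\<in>{i \<in> {s - \<tau>..<m}. j - \<tau> \<le> i \<and> i < j}. msg i)"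
    by (intro sum.cong) auto
  also have "\<dots> = (\<Sum>i\<in>{s - \<tau>..<m}. \<Sum>j\<in>{j \<in> {s..<m}. j - \<tau> \<le> i \<and> i < j}. msg i)"
    by (rule sum.swap_restrict) auto
  also have "\<dots> = (\<Sum>i\<in>{s - \<tau>..<m}. real (card {j \<in> {s..<m}. j - \<tau> \<le> i \<and> i < j}) * msg i)"
    by simp
  also have "\<dots> = (\<Sum>i\<in>{s - \<tau>..<s}. real (card {j \<in> {s..<m}. j - \<tau> \<le> i \<and> i < j}) * msg i)
      + (\<Sum>i\<in>{s..<m}. real (card {j \<in> {s..<m}. j - \<tau> \<le> i \<and> i < j}) * msg i)"
    using assms by (intro sum.atLeastLessThan_concat[symmetric]) auto
  also have "\<dots> \<le> (\<Sum>i\<in>{s - \<tau>..<s}. real (i + \<tau> + 1 - s) * msg i)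
      + (\<Sum>i\<in>{s..<m}. real \<tau> * msg i)"
  proof (intro add_mono sum_mono mult_right_mono msg_nonneg)
    fix i
    have "card {j \<in> {s..<m}. j - \<tau> \<le> i \<and> i < j} \<le> card {s..i + \<tau>}"
      by (rule card_mono) auto
    then show "real (card {j \<in> {s..<m}. j - \<tau> \<le> i \<and> i < j}) \<le> real (i + \<tau> + 1 - s)"
      by simp
    have "card {j \<in> {s..<m}. j - \<tau> \<le> i \<and> i < j} \<le> card {i + 1..i + \<tau>}"
      by (rule card_mono) auto
    then show "real (card {j \<in> {s..<m}. j - \<tau> \<le> i \<and> i < j}) \<le> real \<tau>"
      by simp
  qed
  finally show ?thesis by (simp add: sum_distrib_left)
qed

text \<open>Summing \<open>mse_insert_le\<close> over the steps; the \<open>\<tau>\<close> from the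
  window count merges with \<open>2 * \<beta> * (1 - \<beta>)\<close> into \<open>\<omega>\<close>,
  and windows reaching behind \<open>s\<close> leave the last sum.\<close>

lemma mse_descent:
  assumes "s \<le> m" "m \<le> M"
  shows "mse {..<m} \<le> mse {..<s} - \<omega> * (\<Sum>j\<in>{s..<m}. msg j)
    + \<beta>\<^sup>2 * \<tau> * \<rho> * (\<Sum>i\<in>{s - \<tau>..<s}. real (i + \<tau> + 1 - s) * msg i)"
proof -
  let ?c = "\<beta>\<^sup>2 * \<tau> * \<rho>"
  have "mse {..<m} \<le> mse {..<s} - 2 * \<beta> * (1 - \<beta>) * (\<Sum>j\<in>{s..<m}. msg j)
    + ?c * (\<Sum>j\<in>{s..<m}. \<Sum>i\<in>{j - \<tau>..<j}. msg i)"
    using assms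
  proof (induction m rule: dec_induct)
    case (step k)
    have "mse {..<Suc k} \<le> mse {..<k} - 2 * \<beta> * (1 - \<beta>) * msg k + ?c * (\<Sum>i\<in>{k - \<tau>..<k}. msg i)"
      unfolding lessThan_Suc using step.prems by (intro mse_insert_le) auto
    with step show ?case by (simp add: algebra_simps)
  qed simp
  also have "\<dots> \<le> mse {..<s} - 2 * \<beta> * (1 - \<beta>) * (\<Sum>j\<in>{s..<m}. msg j)
    + ?c * (real \<tau> * (\<Sum>i\<in>{s..<m}. msg i) + (\<Sum>i\<in>{s - \<tau>..<s}. real (i + \<tau> + 1 - s) * msg i))"
    by (intro add_left_mono mult_left_mono sum_windows_le assms) (simp add: rho2_nonneg)
  also have "\<dots> = mse {..<s} - \<omega> * (\<Sum>j\<in>{s..<m}. msg j)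
    + ?c * (\<Sum>i\<in>{s - \<tau>..<s}. real (i + \<tau> + 1 - s) * msg i)"
    by (simp add: omega_def algebra_simps power2_eq_square)
  finally show ?thesis .
qed

text \<open>Each term is at least \<open>lmin / n\<close> times a power of \<open>q\<close> times
  the error at \<open>s\<close>. As \<open>1 - q = lmax / n\<close>, the geometric sum yields (1 -
  \<open>q ^ p\<close>) / \<open>kappa\<close>^2. The lag \<open>t\<close> is the wait until read
  sets contain all of \<open>{..<s}\<close>: 0 for the first epoch, \<open>\<tau>\<close>
  afterwards.\<close>

lemma sum_msg_ge:
  assumes "s + t + p \<le> M" "\<And>j. s + t \<le> j \<Longrightarrow> {..<s} \<subseteq> K j" "q ^ p \<le> 1 / 2"
  shows "q ^ t / (2 * (kappa A)\<^sup>2) * mse {..<s} \<le> (\<Sum>j\<in>{s + t..<s + t + p}. msg j)"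
proof -
  let ?F = "mse {..<s}"
  have "q ^ t * (lmin / lmax) * (1 - q ^ p) * ?F = lmin / real CARD('n) * (q ^ t * (\<Sum>i<p. q ^ i) * ?F)"
  proof -
    have "(\<Sum>i<p. q ^ i) = (1 - q ^ p) / (lmax / real CARD('n))"
      using q_less_1 by (simp add: sum_gp_strict) (simp add: q_def)
    then show ?thesis using card_pos by simp
  qed
  also have "\<dots> = (\<Sum>i<p. lmin / real CARD('n) * (q ^ (t + i) * ?F))"
    by (simp add: sum_distrib_left sum_distrib_right power_add mult_ac)
  also have "\<dots> \<le> (\<Sum>i<p. msg (s + t + i))"
  proof (rule sum_mono)
    fix i assume i: "i \<in> {..<p}"
    have "q ^ (t + i) * ?F \<le> mse (K (s + t + i))"
      using assms(1) assms(2)[of "s + t + i"] K_subset[of "s + t + i"] i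
      by (intro mse_ge_power) (auto simp: add.assoc)
    then have "lmin / real CARD('n) * (q ^ (t + i) * ?F) \<le> lmin / real CARD('n) * mse (K (s + t + i))"
      using lmin_pos by (intro mult_left_mono) auto
    also have "\<dots> \<le> msg (s + t + i)" using assms(1) i by (intro msg_bounds) auto
    finally show "lmin / real CARD('n) * (q ^ (t + i) * ?F) \<le> msg (s + t + i)" .
  qed
  also have "\<dots> = (\<Sum>j\<in>{s + t..<s + t + p}. msg j)"
    using sum.shift_bounds_nat_ivl[of msg 0 "s + t" p] by (simp add: atLeast0LessThan add_ac)
  finally have *: "q ^ t * (lmin / lmax) * (1 - q ^ p) * ?F \<le> (\<Sum>j\<in>{s + t..<s + t + p}. msg j)" .
  have "q ^ t / (2 * (kappa A)\<^sup>2) * ?F = q ^ t * (lmin / lmax) * (1 / 2) * ?F"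
    using lmin_pos lmax_pos by (simp add: kappa_sq)
  also have "\<dots> \<le> q ^ t * (lmin / lmax) * (1 - q ^ p) * ?F"
    using assms(3) lmin_pos lmax_pos q_pos mse_nonneg
    by (intro mult_right_mono mult_left_mono) auto
  finally show ?thesis using * by linarith
qed

lemma first_epoch:
  assumes "m \<le> M" "q ^ m \<le> 1 / 2"
  shows "mse {..<m} \<le> (1 - \<omega> / (2 * (kappa A)\<^sup>2)) * mse {}"
proof -
  have "mse {..<m} \<le> mse {} - \<omega> * (\<Sum>j\<in>{0..<m}. msg j)"
    using mse_descent[of 0 m] assms by simp
  moreover have "\<omega> * (1 / (2 * (kappa A)\<^sup>2) * mse {}) \<le> \<omega> * (\<Sum>j\<in>{0..<m}. msg j)"
    using sum_msg_ge[of 0 0 m] assms omega_positive by (intro mult_left_mono) auto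
  ultimately show ?thesis by (simp add: algebra_simps)
qed

section \<open>Errors of read iterates and the memory term\<close>

lemma mse_backward:
  assumes "i \<le> j" "j \<le> i + k" "j \<le> M"
  shows "mse {..<i} \<le> mse {..<j} / q ^ k"
proof -
  have "q ^ k \<le> q ^ (j - i)"
    using assms q_pos q_less_1 by (intro power_decreasing) auto
  then have "q ^ k * mse {..<i} \<le> q ^ (j - i) * mse {..<i}"
    by (intro mult_right_mono mse_nonneg)
  also have "\<dots> \<le> mse {..<j}"
    using assms by (intro mse_ge_power) auto
  finally show ?thesis using q_pos by (simp add: field_simps)
qed

text \<open>The elements of \<open>L\<close> from \<open>j - \<tau>\<close> on are inserted in
  increasing order. Each insertion obeys \<open>mse_insert_le\<close>, whose decrease is dropped;
  indices outside \<open>L\<close> only add nonnegative terms to the bound.\<close>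

lemma mse_partial_le:
  assumes "L \<subseteq> {..<j}" "{..<j - \<tau>} \<subseteq> L" "j \<le> M"
  shows "mse L \<le> mse {..<j - \<tau>} + \<beta>\<^sup>2 * \<tau> * \<rho> * (\<Sum>l\<in>{j - \<tau>..<j}. \<Sum>i\<in>{l - \<tau>..<l}. msg i)"
proof -
  let ?c = "\<beta>\<^sup>2 * \<tau> * \<rho>" and ?S = "\<lambda>l. \<Sum>i\<in>{l - \<tau>..<l}. msg i"
  have "mse (L \<inter> {..<m}) \<le> mse {..<j - \<tau>} + ?c * (\<Sum>l\<in>{j - \<tau>..<m}. ?S l)"
    if "j - \<tau> \<le> m" "m \<le> j" for m
    using that
  proof (induction m rule: dec_induct)
    case base
    have "L \<inter> {..<j - \<tau>} = {..<j - \<tau>}" using assms by auto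
    then show ?case by simp
  next
    case (step m)
    have S: "0 \<le> ?c * ?S m" by (simp add: rho2_nonneg sum_nonneg msg_nonneg)
    have "mse (L \<inter> {..<Suc m}) \<le> mse (L \<inter> {..<m}) + ?c * ?S m"
    proof (cases "m \<in> L")
      case True
      have "mse (insert m (L \<inter> {..<m})) \<le>
          mse (L \<inter> {..<m}) - 2 * \<beta> * (1 - \<beta>) * msg m + ?c * ?S m"
        using assms step by (intro mse_insert_le) auto
      moreover have "0 \<le> 2 * \<beta> * (1 - \<beta>) * msg m"
        using \<beta>_nonneg \<beta>_less_1 msg_nonneg by simp
      moreover have "L \<inter> {..<Suc m} = insert m (L \<inter> {..<m})"
        using True by (auto simp: less_Suc_eq)
      ultimately show ?thesis by simp
    next
      case False
      then have "L \<inter> {..<Suc m} = L \<inter> {..<m}" by (auto simp: less_Suc_eq)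
      with S show ?thesis by simp
    qed
    with step show ?case by (simp add: algebra_simps)
  qed
  from this[of j] show ?thesis using assms(1) by (simp add: Int_absorb2)
qed

lemma mse_read_le:
  assumes "chi \<le> 1 / 4" "j \<le> M"
  shows "mse (K j) \<le> 4 / (3 * q ^ \<tau>) * mse {..<j}"
  using assms(2)
proof (induction j rule: less_induct)
  case (less j)
  \<comment> \<open>\<open>C\<close> solves 1 / \<open>q ^ \<tau>\<close> + \<open>C\<close> / 4 =
    \<open>C\<close>, which closes the induction.\<close>
  define C where "C = 4 / (3 * q ^ \<tau>)"
  have C: "C \<ge> 0" using q_pos by (simp add: C_def)
  have bound: "msg i \<le> (1 - q) * C / q ^ (2 * \<tau>) * mse {..<j}"
    if "l \<in> {j - \<tau>..<j}" "i \<in> {l - \<tau>..<l}" for l i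
  proof -
    \<comment> \<open>A window inside a window reaches back at most \<open>2 * \<tau>\<close> steps;
      this is the exponent in \<open>chi\<close>.\<close>
    have i: "i < j" "j \<le> i + 2 * \<tau>" using that by auto
    have "msg i \<le> (1 - q) * mse (K i)" using i less.prems by (intro msg_bounds) auto
    also have "\<dots> \<le> (1 - q) * (C * mse {..<i})"
      using i less q_less_1 by (intro mult_left_mono less.IH[folded C_def]) auto
    also have "\<dots> \<le> (1 - q) * (C * (mse {..<j} / q ^ (2 * \<tau>)))"
      using i less.prems q_less_1 C by (intro mult_left_mono mse_backward) auto
    finally show ?thesis by (simp add: mult_ac)
  qed
  have B: "0 \<le> (1 - q) * C / q ^ (2 * \<tau>) * mse {..<j}"
    using q_pos q_less_1 mse_nonneg C by simp
  have "(\<Sum>l\<in>{j - \<tau>..<j}. \<Sum>i\<in>{l - \<tau>..<l}. msg i) \<le>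
      (\<Sum>l\<in>{j - \<tau>..<j}. \<Sum>i\<in>{l - \<tau>..<l}. (1 - q) * C / q ^ (2 * \<tau>) * mse {..<j})"
    by (intro sum_mono bound)
  also have "\<dots> \<le> (\<Sum>l\<in>{j - \<tau>..<j}. real \<tau> * ((1 - q) * C / q ^ (2 * \<tau>) * mse {..<j}))"
    by (intro sum_mono order.trans[OF eq_refl[OF sum_constant]] mult_right_mono B) simp
  also have "\<dots> \<le> real \<tau> * (real \<tau> * ((1 - q) * C / q ^ (2 * \<tau>) * mse {..<j}))"
    unfolding sum_constant by (intro mult_right_mono mult_nonneg_nonneg B) auto
  finally have W: "(\<Sum>l\<in>{j - \<tau>..<j}. \<Sum>i\<in>{l - \<tau>..<l}. msg i) \<le>
    real \<tau> * (real \<tau> * ((1 - q) * C / q ^ (2 * \<tau>) * mse {..<j}))" .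
  have "mse (K j) \<le> mse {..<j - \<tau>} + \<beta>\<^sup>2 * \<tau> * \<rho> * (\<Sum>l\<in>{j - \<tau>..<j}. \<Sum>i\<in>{l - \<tau>..<l}. msg i)"
    using K_subset old_in_K less.prems by (intro mse_partial_le) auto
  also have "\<dots> \<le> mse {..<j} / q ^ \<tau>
      + \<beta>\<^sup>2 * \<tau> * \<rho> * (real \<tau> * (real \<tau> * ((1 - q) * C / q ^ (2 * \<tau>) * mse {..<j})))"
    using less.prems by (intro add_mono mult_left_mono W mse_backward) (auto simp: rho2_nonneg)
  also have "\<dots> = mse {..<j} / q ^ \<tau> + chi * (C * mse {..<j})"
    by (simp add: chi_def power2_eq_square power3_eq_cube mult_ac)
  also have "\<dots> \<le> mse {..<j} / q ^ \<tau> + 1 / 4 * (C * mse {..<j})"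
    using assms(1) C mse_nonneg by (intro add_left_mono mult_right_mono) auto
  also have "\<dots> = C * mse {..<j}"
    using q_pos by (simp add: C_def field_simps)
  finally show ?case by (simp only: C_def)
qed

text \<open>The condition on \<open>C\<close> is what fits the triangular weights of the memory term
  into \<open>chi\<close>. The constant of \<open>mse_read_le\<close> meets it only for
  \<open>\<tau>\<close> at least 2; for \<open>\<tau> = 1\<close> every read set is an initial
  segment and \<open>1 / q\<close> suffices.\<close>

lemma mse_read_bound:
  assumes "chi \<le> 1 / 4" "\<tau> \<ge> 1"
  obtains C :: real where "C \<ge> 0" "C * (\<tau> + 1) \<le> 2 * \<tau> / q ^ \<tau>"
    "\<And>j. j \<le> M \<Longrightarrow> mse (K j) \<le> C * mse {..<j}"
proof (cases "\<tau> = 1")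
  case True
  have "mse (K j) \<le> 1 / q * mse {..<j}" if "j \<le> M" for j
  proof -
    have "\<exists>i. K j = {..<i} \<and> i \<le> j \<and> j \<le> i + 1"
    proof (cases "j - 1 \<in> K j")
      case True
      then have "j - 1 < j" using K_subset[of j] by auto
      moreover have "i \<in> K j" if "i < j" for i
        using True old_in_K[of i j] \<open>\<tau> = 1\<close> that by (cases "i = j - 1") auto
      ultimately have "K j = {..<j}" using K_subset[of j] by auto
      then show ?thesis by auto
    next
      case False
      have "K j = {..<j - 1}"
      proof (intro equalityI subsetI)
        fix i assume i: "i \<in> K j"
        then have "i \<noteq> j - 1" "i < j" using False K_subset[of j] by auto
        then show "i \<in> {..<j - 1}" by simp
      qed (use old_in_K[of _ j] \<open>\<tau> = 1\<close> in auto)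
      then show ?thesis by (intro exI[of _ "j - 1"]) auto
    qed
    then obtain i where "K j = {..<i}" "i \<le> j" "j \<le> i + 1" by blast
    then show ?thesis using mse_backward[of i j 1] that by simp
  qed
  then show ?thesis using that[of "1 / q"] True q_pos by simp
next
  case False
  have "4 / (3 * q ^ \<tau>) * (\<tau> + 1) \<le> 2 * \<tau> / q ^ \<tau>"
    using False assms(2) q_pos by (simp add: field_simps)
  then show ?thesis
    using mse_read_le[OF assms(1)] q_pos by (intro that[of "4 / (3 * q ^ \<tau>)"]) auto
qed

lemma memory_term_le:
  assumes "chi \<le> 1 / 4" "\<tau> \<le> s" "s \<le> M"
  shows "\<beta>\<^sup>2 * \<tau> * \<rho> * (\<Sum>i\<in>{s - \<tau>..<s}. real (i + \<tau> + 1 - s) * msg i) \<le> chi * mse {..<s}"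
proof (cases "\<tau> = 0")
  case True
  then show ?thesis using chi_nonneg mse_nonneg by simp
next
  case False
  then obtain C :: real where C: "C \<ge> 0" "C * (\<tau> + 1) \<le> 2 * \<tau> / q ^ \<tau>"
    "\<And>j. j \<le> M \<Longrightarrow> mse (K j) \<le> C * mse {..<j}"
    using mse_read_bound[OF assms(1)] by (metis One_nat_def Suc_leI neq0_conv)
  let ?B = "(1 - q) * (C * (mse {..<s} / q ^ \<tau>))"
  have "(\<Sum>i\<in>{s - \<tau>..<s}. real (i + \<tau> + 1 - s) * msg i) \<le> (\<Sum>i\<in>{s - \<tau>..<s}. real (i + \<tau> + 1 - s) * ?B)"
  proof (intro sum_mono mult_left_mono)
    fix i assume i: "i \<in> {s - \<tau>..<s}"
    have "msg i \<le> (1 - q) * mse (K i)" using i assms by (intro msg_bounds) auto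
    also have "\<dots> \<le> (1 - q) * (C * mse {..<i})"
      using i assms q_less_1 by (intro mult_left_mono C) auto
    also have "\<dots> \<le> ?B"
      using i assms q_less_1 C by (intro mult_left_mono mse_backward) auto
    finally show "msg i \<le> ?B" .
  qed simp
  also have "\<dots> = (\<tau> * (C * (\<tau> + 1)) / 2) * ((1 - q) * (mse {..<s} / q ^ \<tau>))"
  proof -
    \<comment> \<open>With \<open>\<tau> \<le> s\<close> the window is not truncated at 0, and its
      weights are exactly 1 up to \<open>\<tau>\<close>.\<close>
    obtain p where s: "s = p + \<tau>" using assms(2) by (metis le_add_diff_inverse2)
    have "(\<Sum>i\<in>{s - \<tau>..<s}. real (i + \<tau> + 1 - s)) = (\<Sum>i\<in>{0..<\<tau>}. real (i + 1))"
      using sum.shift_bounds_nat_ivl[of "\<lambda>i. real (i + \<tau> + 1 - s)" 0 p \<tau>] by (simp add: s add_ac)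
    also have "\<dots> = \<tau> * (\<tau> + 1) / 2"
      by (induction \<tau>) (auto simp: field_simps)
    finally have "(\<Sum>i\<in>{s - \<tau>..<s}. real (i + \<tau> + 1 - s) * ?B) = \<tau> * (\<tau> + 1) / 2 * ?B"
      by (simp only: sum_distrib_right[symmetric])
    then show ?thesis by (simp add: field_simps)
  qed
  also have "\<dots> \<le> (\<tau> * (2 * \<tau> / q ^ \<tau>) / 2) * ((1 - q) * (mse {..<s} / q ^ \<tau>))"
    using q_pos q_less_1 mse_nonneg C(2)
    by (intro mult_right_mono divide_right_mono mult_left_mono) auto
  also have "\<dots> = real \<tau> ^ 2 * (1 - q) / q ^ (2 * \<tau>) * mse {..<s}"
    by (simp add: power2_eq_square power_even_eq)
  finally have "\<beta>\<^sup>2 * \<tau> * \<rho> * (\<Sum>i\<in>{s - \<tau>..<s}. real (i + \<tau> + 1 - s) * msg i)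
      \<le> \<beta>\<^sup>2 * \<tau> * \<rho> * (real \<tau> ^ 2 * (1 - q) / q ^ (2 * \<tau>) * mse {..<s})"
    by (intro mult_left_mono) (auto simp: rho2_nonneg)
  then show ?thesis by (simp add: chi_def power2_eq_square power3_eq_cube mult_ac)
qed

section \<open>Combining the epochs\<close>

text \<open>During the first \<open>\<tau>\<close> steps read sets may still miss updates made
  before \<open>s\<close>, so only the following \<open>p\<close> steps enter the lower bound for
  the progress.\<close>

lemma later_epoch:
  assumes "chi \<le> 1 / 4" "\<tau> \<le> s" "s + \<tau> + p \<le> M" "q ^ p \<le> 1 / 2"
  shows "mse {..<s + \<tau> + p} \<le> (1 - \<omega> * q ^ \<tau> / (2 * (kappa A)\<^sup>2) + chi) * mse {..<s}"
proof -
  have "q ^ \<tau> / (2 * (kappa A)\<^sup>2) * mse {..<s} \<le> (\<Sum>j\<in>{s + \<tau>..<s + \<tau> + p}. msg j)"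
    using assms old_in_K by (intro sum_msg_ge) auto
  also have "\<dots> \<le> (\<Sum>j\<in>{s..<s + \<tau> + p}. msg j)"
    by (intro sum_mono2 msg_nonneg) auto
  finally have "\<omega> * (q ^ \<tau> / (2 * (kappa A)\<^sup>2) * mse {..<s}) \<le> \<omega> * (\<Sum>j\<in>{s..<s + \<tau> + p}. msg j)"
    using omega_positive by (intro mult_left_mono) auto
  moreover have "mse {..<s + \<tau> + p} \<le> mse {..<s} - \<omega> * (\<Sum>j\<in>{s..<s + \<tau> + p}. msg j) + chi * mse {..<s}"
    using mse_descent[of s "s + \<tau> + p"] memory_term_le[of s] assms by simp
  ultimately show ?thesis by (simp add: algebra_simps)
qed

text \<open>Since \<open>2 * \<beta> * (1 - \<beta>)\<close> is at most 1/2 and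
  \<open>lmin \<le> lmax\<close>. It keeps the contraction factors nonnegative and forces
  \<open>chi \<le> 1 / 4\<close> whenever \<open>chi\<close> is below the decrement.\<close>

lemma decrement_le: "\<omega> * q ^ k / (2 * (kappa A)\<^sup>2) \<le> 1 / 4"
proof -
  have "\<omega> \<le> 2 * \<beta> * (1 - \<beta>)"
    using \<beta>_nonneg rho2_nonneg by (simp add: omega_def algebra_simps)
  also have "\<dots> = 1 / 2 - 2 * (\<beta> - 1 / 2)\<^sup>2" by (simp add: power2_eq_square algebra_simps)
  also have "\<dots> \<le> 1 / 2" by simp
  finally have \<omega>: "\<omega> \<le> 1 / 2" .
  have "\<omega> * q ^ k / (2 * (kappa A)\<^sup>2) = \<omega> * q ^ k * (lmin / lmax) / 2"
    by (simp add: kappa_sq)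
  also have "\<dots> \<le> 1 / 2 * 1 * 1 / 2"
    using \<omega> omega_positive q_pos q_less_1 lmin_pos lmax_pos lmin_le_lmax
    by (intro divide_right_mono mult_mono) (auto intro: power_le_one)
  finally show ?thesis by simp
qed

lemma all_epochs:
  assumes "q ^ T0 \<le> 1 / 2" "r \<ge> 1" "m \<ge> r * (T0 + \<tau>)" "m \<le> M"
  shows "mse {..<m} \<le> (1 - \<omega> / (2 * (kappa A)\<^sup>2))
    * (1 - \<omega> * q ^ \<tau> / (2 * (kappa A)\<^sup>2) + chi) ^ (r - 1) * mse {}"
proof -
  let ?a = "1 - \<omega> / (2 * (kappa A)\<^sup>2)"
  let ?c = "\<omega> * q ^ \<tau> / (2 * (kappa A)\<^sup>2)"
  have a: "?a \<ge> 0" using decrement_le[of 0] by simp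
  have first: "mse {..<m} \<le> ?a * mse {}" if "m \<ge> r * (T0 + \<tau>)" "r \<ge> 1" "m \<le> M" for r m
  proof (rule first_epoch)
    have "T0 \<le> 1 * (T0 + \<tau>)" by simp
    also have "\<dots> \<le> r * (T0 + \<tau>)" using that(2) by (rule mult_le_mono1)
    finally have "q ^ m \<le> q ^ T0" using that q_pos q_less_1 by (intro power_decreasing) auto
    with assms(1) show "q ^ m \<le> 1 / 2" by simp
  qed fact
  show ?thesis
  proof (cases "?c \<le> chi")
    case True
    have "?a * 1 * mse {} \<le> ?a * (1 - ?c + chi) ^ (r - 1) * mse {}"
      using a True mse_nonneg by (intro mult_right_mono mult_left_mono one_le_power) auto
    then show ?thesis using first[OF assms(3,2,4)] by simp
  next
    case False
    then have chi: "chi \<le> 1 / 4" using decrement_le[of \<tau>] by linarith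
    have nonneg: "0 \<le> 1 - ?c + chi" using decrement_le[of \<tau>] chi_nonneg by linarith
    show ?thesis
      using assms(2-4)
    proof (induction r arbitrary: m rule: dec_induct)
      case base
      then show ?case using first[of 1 m] by simp
    next
      case (step r)
      \<comment> \<open>Epochs are peeled off from the end with exact length
        \<open>T0 + \<tau>\<close>, so any surplus in \<open>m\<close> is absorbed by the first
        epoch.\<close>
      define s where "s = m - (T0 + \<tau>)"
      have s: "r * (T0 + \<tau>) \<le> s" "m = s + \<tau> + T0" "s \<le> M"
        using step.prems by (auto simp: s_def)
      \<comment> \<open>At least one epoch precedes \<open>s\<close>, which gives the
        \<open>\<tau> \<le> s\<close> required by \<open>later_epoch\<close>.\<close>
      have "1 * (T0 + \<tau>) \<le> r * (T0 + \<tau>)" using step.hyps(1) by (rule mult_le_mono1)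
      also note s(1)
      finally have "\<tau> \<le> s" by simp
      then have "mse {..<m} \<le> (1 - ?c + chi) * mse {..<s}"
        unfolding s(2) using s step.prems chi assms(1) by (intro later_epoch) auto
      also have "\<dots> \<le> (1 - ?c + chi) * (?a * (1 - ?c + chi) ^ (r - 1) * mse {})"
        using s nonneg by (intro mult_left_mono step.IH) auto
      also have "\<dots> = ?a * (1 - ?c + chi) ^ (Suc r - 1) * mse {}"
        using step.hyps(1) by (cases r) (auto simp: mult_ac)
      finally show ?case .
    qed
  qed
qed

section \<open>Translation to the stated bounds\<close>

lemma expectation_eq_mse:
  "measure_pmf.expectation (dirs M) (\<lambda>d. normX_sq X (xiter A b x0 \<beta> K d m - xstar)) = mse {..<m}"
  by (simp only: mse_def xiter_minus_xstar)

lemma mse_empty: "mse {} = normX_sq X (x0 - xstar)"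
  by (simp add: mse_def err_def)

lemma power_le_half:
  assumes "ln (1 / 2) / ln q \<le> real m"
  shows "q ^ m \<le> 1 / 2"
proof -
  have "ln q < 0" using q_pos q_less_1 by simp
  then have "real m * ln q \<le> ln (1 / 2)" using assms by (simp add: neg_divide_le_eq)
  then have "ln (q ^ m) \<le> ln (1 / 2)" using q_pos by (simp add: ln_realpow)
  then show ?thesis using q_pos by (subst (asm) ln_le_cancel_iff) auto
qed

end

theorem theorem4:
  fixes A :: "real^'n::finite^'N::finite" and b :: "real^'N"
    and xstar x0 :: "real^'n" and \<beta> :: real and \<tau> :: nat
    and K :: "nat \<Rightarrow> nat set"
  assumes dims: "CARD('N) \<ge> CARD('n)" "CARD('n) \<ge> 2"
    and fullrank: "rank A = CARD('n)"
    and unitcols: "\<forall>i. norm (column i A) = 1"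
    and xstar: "\<forall>x. norm (A *v xstar - b) \<le> norm (A *v x - b)"
    and beta: "0 \<le> \<beta>" "\<beta> < 1"
    and Kj: "\<forall>j. {i. i + \<tau> + 1 \<le> j} \<subseteq> K j \<and> K j \<subseteq> {..<j}"
    and omega_pos: "omega (rho2 A) \<tau> \<beta> > 0"
  shows
   "(\<forall>m::nat. real m \<ge> ln (1/2) / ln (1 - (sigma_max A)^2 / real CARD('n)) \<longrightarrow>
      measure_pmf.expectation (dirs m)
        (\<lambda>d. normX_sq (transpose A ** A) (xiter A b x0 \<beta> K d m - xstar))
      \<le> (1 - omega (rho2 A) \<tau> \<beta> / (2 * (kappa A)^2)) * normX_sq (transpose A ** A) (x0 - xstar))
    \<and>
    (let q = 1 - (sigma_max A)^2 / real CARD('n);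
         T0 = \<lceil>ln (1/2) / ln q\<rceil>;
         T = T0 + int \<tau>;
         \<omega> = omega (rho2 A) \<tau> \<beta>;
         chi = rho2 A * real \<tau>^3 * \<beta>^2 * (sigma_max A)^2 * (1 / q ^ (2 * \<tau>)) / real CARD('n)
     in \<forall>r::nat. \<forall>m::nat. r \<ge> 1 \<longrightarrow> int m \<ge> int r * T \<longrightarrow>
      measure_pmf.expectation (dirs m)
        (\<lambda>d. normX_sq (transpose A ** A) (xiter A b x0 \<beta> K d m - xstar))
      \<le> (1 - \<omega> / (2 * (kappa A)^2))
         * (1 - \<omega> * q ^ \<tau> / (2 * (kappa A)^2) + chi) ^ (r - 1)
         * normX_sq (transpose A ** A) (x0 - xstar))"
proof -
  have loc: "async_least_squares A b xstar \<beta> \<tau> K"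
  proof
    show "inj ((*v) A)" using fullrank by (simp add: full_rank_injective)
    show "i \<in> K j" if "i + \<tau> < j" for i j
      using Kj that by (metis (mono_tags) Suc_eq_plus1 Suc_leI mem_Collect_eq subsetD)
  qed (use assms in auto)
  \<comment> \<open>The horizon stays free, so each claim about \<open>x_m\<close> can be read on
    its own space \<open>dirs m\<close>.\<close>
  interpret async_least_squares A b xstar x0 \<beta> \<tau> K m for m by (rule loc)
  define T0 where "T0 = \<lceil>ln (1 / 2) / ln q\<rceil>"
  have "0 \<le> ln (1 / 2) / ln q" using q_pos q_less_1 by (simp add: divide_nonpos_neg)
  then have T0_nonneg: "0 \<le> T0" by (simp add: T0_def)
  have "ln (1 / 2) / ln q \<le> real_of_int T0" unfolding T0_def by (rule le_of_int_ceiling)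
  then have half: "q ^ nat T0 \<le> 1 / 2" using T0_nonneg by (intro power_le_half) simp
  have q: "1 - (sigma_max A)^2 / real CARD('n) = q" by (simp add: q_def sigma_max_sq)
  have chi: "rho2 A * real \<tau>^3 * \<beta>^2 * (sigma_max A)^2 * (1 / q ^ (2 * \<tau>)) / real CARD('n) = chi"
    by (simp add: chi_def q_def sigma_max_sq)
  show ?thesis
    unfolding Let_def q chi expectation_eq_mse T0_def[symmetric]
  proof (intro conjI allI impI)
    fix m :: nat
    assume "ln (1 / 2) / ln q \<le> real m"
    then show "mse m {..<m} \<le> (1 - omega (rho2 A) \<tau> \<beta> / (2 * (kappa A)\<^sup>2)) * normX_sq X (x0 - xstar)"
      using first_epoch[of m m] power_le_half by (simp only: mse_empty order.refl)
  next
    fix m r :: nat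
    assume "1 \<le> r" and m: "int r * (T0 + int \<tau>) \<le> int m"
    have "int (r * (nat T0 + \<tau>)) \<le> int m" using m T0_nonneg by simp
    then have "r * (nat T0 + \<tau>) \<le> m" by (simp only: of_nat_le_iff)
    with half \<open>1 \<le> r\<close> show "mse m {..<m} \<le> (1 - omega (rho2 A) \<tau> \<beta> / (2 * (kappa A)\<^sup>2))
        * (1 - omega (rho2 A) \<tau> \<beta> * q ^ \<tau> / (2 * (kappa A)\<^sup>2) + chi) ^ (r - 1)
        * normX_sq X (x0 - xstar)"
      using all_epochs[of "nat T0" r m m] by (simp only: mse_empty order.refl)
  qed
qed

end
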